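(* Let $w\in\mathbb C^d$, $w\ne0$, let $s_1,\dots,s_R\in\{1,\dots,d\}$ be distinct shift positions, let $y^1,\dots,y^R\in[0,\infty)^d$ be ptychographic measurements, and let $A$ be the matrix with row blocks $A_r=F\operatorname{diag}(S_{s_r}w)$, $r\in\{1,\dots,R\}$. The iteration of the Ptychographic Iterative Engine, $$z^{t+1}=z^t+\frac{\alpha_t}{\|w\|_\infty^2}\operatorname{diag}(\overline{S_{s_{r^t}}w})\left[F^{-1}\left(\sqrt{y^{r^t}}\circ\operatorname{sgn}\left(F[S_{s_{r^t}}w\circ z^t]\right)\right)-S_{s_{r^t}}w\circ z^t\right],$$ with parameters $\alpha_t>0$ and where $r^t=r$ is chosen with probability $p_r$, $r\in\{1,\dots,R\}$, is the iteration of Stochastic Amplitude Flow $z^{t+1}=z^t-\mu_t\,g_0(z^t)$ with $\varepsilon=0$ and step size $$\mu_t=\frac{\alpha_tp_{r^t}}{d\|w\|_\infty^2}=\frac{\alpha_tp_{r^t}}{\|A_{r^t}\|^2},$$ where the stochastic gradient $g_0$ of $\mathcal L_0$ is constructed from the partition $A_1,\dots,A_R$ of $A$ and samples $K=1$ index $r^t$ from the distribution $p$, i.e. $g_0(z)=\frac{1}{p_{r^t}}\nabla_z\mathcal L_{0,r^t}(z)$.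
   Context: $F\in\mathbb C^{d\times d}$ is the discrete Fourier transform matrix, $F_{k,j}=e^{-2\pi i(k-1)(j-1)/d}$. $S_s$ is the circular shift $(S_sv)_j=v_{((j-1-s)\bmod d)+1}$, $j\in\{1,\dots,d\}$. $\operatorname{diag}(v)$ is the diagonal matrix with diagonal $v$; $\overline v$ is the complex conjugate; $\circ$ is the entrywise product; $|\cdot|$, $\sqrt\cdot$ and $\operatorname{sgn}$ act entrywise, with $\operatorname{sgn}(a)=a/|a|$ for $a\ne0$ and $\operatorname{sgn}(0)=0$. $\|\cdot\|$ is the spectral norm. Ptychographic measurements are $y^r=|F[S_{s_r}w\circ x]|^2+n^r$ for an unknown $x\in\mathbb C^d$ and perturbations $n^r$, $1\le r\le R\le d$. Set $y=((y^1)^T,\dots,(y^R)^T)^T$ and let $A$ be the vertical stack of $A_1,\dots,A_R$. The losses are $\mathcal L_{0,r}(z)=\||A_rz|-\sqrt{y^r}\|_2^2$ and $\mathcal L_0=\sum_{r=1}^R\mathcal L_{0,r}$, with generalized Wirtinger gradients $\nabla_z\mathcal L_{0,r}(z)=A_r^*(A_rz-\sqrt{y^r}\circ\operatorname{sgn}(A_rz))$. The probabilities satisfy $0<p_r<1$ and $\sum_rp_r=1$. In general the stochastic gradient is $g_0(z)=\frac1K\sum_{k=1}^K\frac1{p_{r_k}}\nabla_z\mathcal L_{0,r_k}(z)$ with $r_1,\dots,r_K$ drawn independently from $p$. *)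

theory Defs
  imports "HOL-Probability.Probability"
begin

text \<open>
  \<open>\<complex>\<^sup>d\<close> is \<open>complex ^ 'd\<close> with \<open>d = CARD('d)\<close>. The linear order on \<open>'d\<close> only serves to identify the
  index type with \<open>{1..d}\<close>: \<open>pos j\<close> is the 1-based position of \<open>j\<close>, and \<open>coord k\<close> the index at
  position \<open>k\<close>. The entrywise product \<open>\<circ>\<close> is the library's \<open>*\<close> on vectors.
\<close>

definition pos :: "'d::{finite,linorder} \<Rightarrow> nat" where
  "pos j = card {..j}"

definition coord :: "nat \<Rightarrow> 'd::{finite,linorder}" where
  "coord = inv pos"

lemma bij_betw_pos: "bij_betw (pos :: 'd::{finite,linorder} \<Rightarrow> nat) UNIV {1..CARD('d)}"
proof -
  have "pos i < pos j" if "i < j" for i j :: 'd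
    unfolding pos_def using that by (intro psubset_card_mono) auto
  then have inj: "inj (pos :: 'd \<Rightarrow> nat)"
    by (metis injI less_irrefl neqE)
  have "range (pos :: 'd \<Rightarrow> nat) \<subseteq> {1..CARD('d)}"
    unfolding pos_def by (auto intro!: card_mono simp: Suc_le_eq card_gt_0_iff)
  then have "range (pos :: 'd \<Rightarrow> nat) = {1..CARD('d)}"
    by (intro card_subset_eq) (simp_all add: card_image[OF inj])
  with inj show ?thesis by (simp add: bij_betw_def)
qed

definition entrywise :: "('a \<Rightarrow> 'b) \<Rightarrow> 'a ^ 'n \<Rightarrow> 'b ^ 'n" where
  "entrywise f v = (\<chi> j. f (v $ j))"

definition diag :: "'a::zero ^ 'n \<Rightarrow> 'a ^ 'n ^ 'n" where
  "diag v = (\<chi> i j. if i = j then v $ i else 0)"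

definition conj_transpose :: "complex ^ 'n ^ 'm \<Rightarrow> complex ^ 'm ^ 'n" where
  "conj_transpose A = (\<chi> i j. cnj (A $ j $ i))"

definition spectral_norm :: "complex ^ 'n ^ 'm \<Rightarrow> real" where
  "spectral_norm A = onorm ((*v) A)"

text \<open>The library's \<open>infnorm\<close> is not the maximum norm on \<open>\<complex>\<^sup>d\<close>: it takes the maximum over the real and
  imaginary parts separately.\<close>

definition max_norm :: "complex ^ 'n \<Rightarrow> real" where
  "max_norm v = Max (range (\<lambda>j. cmod (v $ j)))"

definition DFT :: "complex ^ 'd::{finite,linorder} ^ 'd::{finite,linorder}" where
  "DFT = (\<chi> k j. exp (- 2 * of_real pi * \<i> * of_nat (pos k - 1) * of_nat (pos j - 1) / of_nat CARD('d)))"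

definition shift :: "nat \<Rightarrow> 'a ^ 'd::{finite,linorder} \<Rightarrow> 'a ^ 'd::{finite,linorder}" where
  "shift s v = (\<chi> j. v $ coord (nat ((int (pos j) - 1 - int s) mod int CARD('d)) + 1))"

text \<open>
  The blocks are indexed by a finite type \<open>'r\<close> with \<open>R = CARD('r)\<close>, and a stack of \<open>R\<close> blocks of
  height \<open>d\<close> is indexed by \<open>'r \<times> 'd\<close>. Since matrices are vectors of rows, \<open>block\<close> extracts both the
  blocks \<open>y\<^sup>r\<close> of a stacked vector and the row blocks \<open>A\<^sub>r\<close> of a stacked matrix.
\<close>

definition block :: "'a ^ ('r::finite \<times> 'd::finite) \<Rightarrow> 'r \<Rightarrow> 'a ^ 'd" where
  "block v r = (\<chi> k. v $ (r, k))"

definition ptycho_matrix ::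
    "complex ^ 'd::{finite,linorder} \<Rightarrow> ('r \<Rightarrow> nat) \<Rightarrow>
     complex ^ 'd::{finite,linorder} ^ ('r::finite \<times> 'd::{finite,linorder})" where
  "ptycho_matrix w s = (\<chi> i. (DFT ** diag (shift (s (fst i)) w)) $ snd i)"

lemma block_ptycho_matrix: "block (ptycho_matrix w s) r = DFT ** diag (shift (s r) w)"
  by (simp add: block_def ptycho_matrix_def vec_eq_iff)

definition ptycho_measurement ::
    "complex ^ 'd::{finite,linorder} \<Rightarrow> nat \<Rightarrow> complex ^ 'd::{finite,linorder} \<Rightarrow>
     real ^ 'd::{finite,linorder} \<Rightarrow> real ^ 'd::{finite,linorder}" where
  "ptycho_measurement w s x n = entrywise (\<lambda>a. (cmod a)\<^sup>2) (DFT *v (shift s w * x)) + n"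

definition amp_loss_block ::
    "complex ^ 'n ^ ('r::finite \<times> 'd::finite) \<Rightarrow>
     real ^ ('r::finite \<times> 'd::finite) \<Rightarrow> 'r \<Rightarrow> complex ^ 'n \<Rightarrow> real" where
  "amp_loss_block A y r z =
     (norm (entrywise cmod (block A r *v z) - entrywise sqrt (block y r)))\<^sup>2"

definition amp_loss ::
    "complex ^ 'n ^ ('r::finite \<times> 'd::finite) \<Rightarrow>
     real ^ ('r::finite \<times> 'd::finite) \<Rightarrow> complex ^ 'n \<Rightarrow> real" where
  "amp_loss A y z = (\<Sum>r\<in>UNIV. amp_loss_block A y r z)"

text \<open>\<open>sgn\<close> on the type \<open>complex\<close> is \<open>a / |a|\<close> with \<open>sgn 0 = 0\<close>; on vectors it would be \<open>v / \<parallel>v\<parallel>\<close>,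
  hence \<open>entrywise\<close>.\<close>

definition amp_grad_block ::
    "complex ^ 'n ^ ('r::finite \<times> 'd::finite) \<Rightarrow>
     real ^ ('r::finite \<times> 'd::finite) \<Rightarrow> 'r \<Rightarrow> complex ^ 'n \<Rightarrow> complex ^ 'n" where
  "amp_grad_block A y r z =
     conj_transpose (block A r) *v
       (block A r *v z
        - entrywise (\<lambda>a. of_real (sqrt a)) (block y r) * entrywise sgn (block A r *v z))"

lemma conj_transpose_inner: "(conj_transpose B *v u) \<bullet> h = u \<bullet> (B *v h)"
proof -
  have "(conj_transpose B *v u) \<bullet> h = (\<Sum>i\<in>UNIV. \<Sum>j\<in>UNIV. (cnj (B $ j $ i) * u $ j) \<bullet> h $ i)"
    by (simp add: inner_vec_def matrix_vector_mult_def conj_transpose_def inner_sum_left)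
  also have "\<dots> = (\<Sum>j\<in>UNIV. \<Sum>i\<in>UNIV. u $ j \<bullet> (B $ j $ i * h $ i))"
    by (subst sum.swap) (simp add: inner_complex_def algebra_simps)
  also have "\<dots> = u \<bullet> (B *v h)"
    by (simp add: inner_vec_def matrix_vector_mult_def inner_sum_right)
  finally show ?thesis .
qed

text \<open>
  Where \<open>A\<^sub>r z\<close> has no zero entry, the loss is real differentiable and the generalized gradient is the
  Wirtinger gradient \<open>(\<partial>L/\<partial>z)\<^sup>*\<close>, i.e. half of the real gradient (\<open>\<bullet>\<close> is the real part of
  the Hermitian inner product).
\<close>

lemma amp_loss_block_has_derivative:
  assumes "\<And>k. (block A r *v z) $ k \<noteq> 0"
  shows "(amp_loss_block A y r has_derivative (\<lambda>h. 2 * (amp_grad_block A y r z \<bullet> h))) (at z)"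
proof -
  let ?B = "block A r"
  have L: "amp_loss_block A y r = (\<lambda>z. \<Sum>k\<in>UNIV. (cmod ((?B *v z) $ k) - sqrt (block y r $ k))\<^sup>2)"
    by (simp add: fun_eq_iff amp_loss_block_def entrywise_def norm_vec_def L2_set_def sum_nonneg)
  have bl: "bounded_linear (\<lambda>z. (?B *v z) $ k)" for k
    by (intro linear_conv_bounded_linear[THEN iffD1] linearI)
       (simp_all add: matrix_vector_mult_def scaleR_right.sum sum.distrib distrib_left)
  have "((\<lambda>z. cmod ((?B *v z) $ k)) has_derivative (\<lambda>h. sgn ((?B *v z) $ k) \<bullet> (?B *v h) $ k)) (at z)" for k
    using has_derivative_compose[OF bounded_linear_imp_has_derivative[OF bl] has_derivative_norm[OF assms]]
    by (simp add: inner_commute)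
  note D = this
  have "(amp_loss_block A y r has_derivative (\<lambda>h. \<Sum>k\<in>UNIV.
     2 * (cmod ((?B *v z) $ k) - sqrt (block y r $ k)) * (sgn ((?B *v z) $ k) \<bullet> (?B *v h) $ k))) (at z)"
    unfolding L by (rule derivative_eq_intros D refl | simp add: algebra_simps)+
  moreover have "2 * (cmod a - sqrt b) * (sgn a \<bullet> h) = 2 * ((a - of_real (sqrt b) * sgn a) \<bullet> h)" if "a \<noteq> 0" for a h b
  proof -
    have "a = cmod a *\<^sub>R sgn a" using that by (simp add: sgn_div_norm)
    then have "a - of_real (sqrt b) * sgn a = (cmod a - sqrt b) *\<^sub>R sgn a"
      by (simp add: algebra_simps scaleR_conv_of_real)
    then show ?thesis by simp
  qed
  ultimately show ?thesis
    using assms unfolding amp_grad_block_def conj_transpose_inner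
    by (simp add: inner_vec_def entrywise_def sum_distrib_left)
qed

definition stoch_grad ::
    "('r \<Rightarrow> real) \<Rightarrow> complex ^ 'n ^ ('r::finite \<times> 'd::finite) \<Rightarrow>
     real ^ ('r::finite \<times> 'd::finite) \<Rightarrow>
     nat \<Rightarrow> (nat \<Rightarrow> 'r) \<Rightarrow> complex ^ 'n \<Rightarrow> complex ^ 'n" where
  "stoch_grad p A y K rs z =
     (1 / real K) *\<^sub>R (\<Sum>k = 1..K. (1 / p (rs k)) *\<^sub>R amp_grad_block A y (rs k) z)"

definition iid_samples ::
    "'w measure \<Rightarrow> ('r \<Rightarrow> real) \<Rightarrow> 'i set \<Rightarrow> ('i \<Rightarrow> 'w \<Rightarrow> 'r) \<Rightarrow> bool" where
  "iid_samples M p I X \<longleftrightarrow>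
     prob_space.indep_vars M (\<lambda>_. count_space UNIV) X I \<and>
     (\<forall>i\<in>I. \<forall>r. measure M {\<omega> \<in> space M. X i \<omega> = r} = p r)"

text \<open>
  \<open>saf_iteration M p A y K \<mu> \<rho> Z\<close>: the random sequence \<open>Z\<close> is produced by Stochastic Amplitude Flow
  (with \<open>\<epsilon> = 0\<close>) for \<open>(A, y)\<close>, where \<open>\<rho> t 1, \<dots>, \<rho> t K\<close> are the indices sampled in step \<open>t\<close>. The step size
  \<open>\<mu> t\<close> may depend on the outcome of the sampling. The initial guess \<open>Z 0\<close> is arbitrary.
\<close>

definition saf_iteration ::
    "'w measure \<Rightarrow> ('r \<Rightarrow> real) \<Rightarrow> complex ^ 'n ^ ('r::finite \<times> 'd::finite) \<Rightarrow>
     real ^ ('r::finite \<times> 'd::finite) \<Rightarrow> nat \<Rightarrow>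
     (nat \<Rightarrow> 'w \<Rightarrow> real) \<Rightarrow> (nat \<Rightarrow> nat \<Rightarrow> 'w \<Rightarrow> 'r) \<Rightarrow> (nat \<Rightarrow> 'w \<Rightarrow> complex ^ 'n) \<Rightarrow> bool" where
  "saf_iteration M p A y K \<mu> \<rho> Z \<longleftrightarrow>
     iid_samples M p (UNIV \<times> {1..K}) (\<lambda>(t, k). \<rho> t k) \<and>
     (\<forall>\<omega>\<in>space M. \<forall>t.
        Z (Suc t) \<omega> = Z t \<omega> - \<mu> t \<omega> *\<^sub>R stoch_grad p A y K (\<lambda>k. \<rho> t k \<omega>) (Z t \<omega>))"

definition pie_update ::
    "complex ^ 'd::{finite,linorder} \<Rightarrow> ('r \<Rightarrow> nat) \<Rightarrow>
     real ^ ('r::finite \<times> 'd::{finite,linorder}) \<Rightarrow> real \<Rightarrow> 'r \<Rightarrow>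
     complex ^ 'd::{finite,linorder} \<Rightarrow> complex ^ 'd::{finite,linorder}" where
  "pie_update w s y a r z =
     z + (a / (max_norm w)\<^sup>2) *\<^sub>R
       (diag (entrywise cnj (shift (s r) w)) *v
         (matrix_inv DFT *v
            (entrywise (\<lambda>b. of_real (sqrt b)) (block y r)
             * entrywise sgn (DFT *v (shift (s r) w * z)))
          - shift (s r) w * z))"

definition pie_iteration ::
    "'w measure \<Rightarrow> ('r \<Rightarrow> real) \<Rightarrow> complex ^ 'd::{finite,linorder} \<Rightarrow> ('r \<Rightarrow> nat) \<Rightarrow>
     real ^ ('r::finite \<times> 'd::{finite,linorder}) \<Rightarrow>
     (nat \<Rightarrow> real) \<Rightarrow> (nat \<Rightarrow> 'w \<Rightarrow> 'r) \<Rightarrow> (nat \<Rightarrow> 'w \<Rightarrow> complex ^ 'd::{finite,linorder}) \<Rightarrow> bool" where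
  "pie_iteration M p w s y \<alpha> \<rho> Z \<longleftrightarrow>
     iid_samples M p UNIV \<rho> \<and>
     (\<forall>\<omega>\<in>space M. \<forall>t. Z (Suc t) \<omega> = pie_update w s y (\<alpha> t) (\<rho> t \<omega>) (Z t \<omega>))"

end

theory Submission
  imports Defs
begin

text \<open>
  The columns of the DFT matrix \<open>F\<close> are orthogonal: the inner product of columns \<open>i\<close> and \<open>j\<close> is the
  sum of the first \<open>d\<close> powers of a \<open>d\<close>-th root of unity that equals \<open>1\<close> only for \<open>i = j\<close>. So
  \<open>F\<^sup>* F = d I\<close>, which says two things at once: \<open>F\<^sup>*\<close> is \<open>d\<close> times the inverse of \<open>F\<close>, and \<open>F\<close> is
  \<open>\<surd>d\<close> times an isometry.

  The first fact identifies the two updates. With \<open>v = S\<^sub>s w\<close> and \<open>A\<^sub>r = F diag(v)\<close>, the adjoint is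
  \<open>A\<^sub>r\<^sup>* = diag(cnj v) F\<^sup>* = d diag(cnj v) F\<^sup>-\<^sup>1\<close>; applied to \<open>A\<^sub>r z - c\<close>, where \<open>c\<close> is the vector of
  measured amplitudes with the phases of \<open>A\<^sub>r z\<close>, it gives \<open>d diag(cnj v) (v \<circ> z - F\<^sup>-\<^sup>1 c)\<close>
  (\<open>amp_grad_block_ptycho\<close>). This is \<open>-d\<close> times the direction of the Ptychographic Iterative Engine,
  so that the engine takes a gradient step of size \<open>\<alpha> / (d \<parallel>w\<parallel>\<^sub>\<infinity>\<^sup>2)\<close>; the factor \<open>p\<^sub>r\<close> in the step
  size cancels the weight \<open>1 / p\<^sub>r\<close> of the stochastic gradient.

  The second fact gives the other form of the step size: \<open>\<parallel>F diag(v)\<parallel> = \<surd>d \<parallel>diag(v)\<parallel> = \<surd>d \<parallel>v\<parallel>\<^sub>\<infinity>\<close>, and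
  \<open>\<parallel>v\<parallel>\<^sub>\<infinity> = \<parallel>w\<parallel>\<^sub>\<infinity>\<close> because a circular shift only permutes the entries (\<open>spectral_norm_ptycho_block\<close>).

  As the updates agree for every index and every point, the two random iterations agree once their
  sampling conditions do; these differ only in whether a family is indexed by \<open>t\<close> or by the pair
  \<open>(t, 1)\<close> (\<open>iid_samples_single\<close>).
\<close>

section \<open>Diagonal matrices, adjoints and circular shifts\<close>

lemma diag_mult_vec: "diag v *v u = v * u"
  for u v :: "'a::semiring_1 ^ 'n"
  by (simp add: vec_eq_iff diag_def matrix_vector_mult_def if_distrib if_distribR cong: if_cong)

lemma conj_transpose_matrix_mult: "conj_transpose (A ** B) = conj_transpose B ** conj_transpose A"
  by (simp add: vec_eq_iff conj_transpose_def matrix_matrix_mult_def mult.commute)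

lemma conj_transpose_diag: "conj_transpose (diag v) = diag (entrywise cnj v)"
  by (auto simp: vec_eq_iff conj_transpose_def diag_def entrywise_def)

text \<open>
  Surjectivity of the index map suffices here: entry \<open>i\<close> of \<open>v\<close> reappears at the position of \<open>i\<close>
  moved forward by \<open>k\<close>, modulo \<open>d\<close>.
\<close>

lemma range_shift: "range (\<lambda>j. shift k v $ j) = range (($) v)"
  for v :: "'a ^ 'd::{finite,linorder}"
proof -
  let ?n = "CARD('d)"
  let ?q = "\<lambda>j :: 'd. nat ((int (pos j) - 1 - int k) mod int ?n) + 1"
  have n: "int ?n > 0"
    by simp
  have pos_coord: "pos (coord m :: 'd) = m" if "m \<in> {1..?n}" for m
    using that bij_betw_pos[where 'd='d] unfolding coord_def bij_betw_def
    by (metis f_inv_into_f)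
  have coord_pos: "coord (pos i) = i" for i :: 'd
    using bij_betw_pos[where 'd='d] unfolding coord_def bij_betw_def
    by (simp add: inv_f_f)
  have pos_range: "pos i \<in> {1..?n}" for i :: 'd
    using bij_betw_pos[where 'd='d] by (auto simp: bij_betw_def)
  have preimage: "\<exists>j :: 'd. coord (?q j) = i" for i :: 'd
  proof -
    let ?j = "coord (nat ((int (pos i) - 1 + int k) mod int ?n) + 1) :: 'd"
    have "nat ((int (pos i) - 1 + int k) mod int ?n) < ?n"
      using n by (simp add: nat_less_iff)
    then have "int (pos ?j) - 1 = (int (pos i) - 1 + int k) mod int ?n"
      by (subst pos_coord) auto
    then have "(int (pos ?j) - 1 - int k) mod int ?n = (int (pos i) - 1) mod int ?n"
      by (simp add: mod_diff_left_eq)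
    also have "\<dots> = int (pos i) - 1"
      using pos_range[of i] by (intro mod_pos_pos_trivial) auto
    finally have "(int (pos ?j) - 1 - int k) mod int ?n = int (pos i) - 1" .
    then have "?q ?j = nat (int (pos i) - 1) + 1"
      by (simp only:)
    also have "\<dots> = pos i"
      using pos_range[of i] by (simp add: nat_diff_distrib')
    finally have "?q ?j = pos i" .
    then have "coord (?q ?j) = i"
      by (simp only: coord_pos)
    then show ?thesis ..
  qed
  have surj: "range (\<lambda>j :: 'd. coord (?q j)) = (UNIV :: 'd set)"
  proof (intro set_eqI iffI UNIV_I)
    fix i :: 'd
    obtain j where "coord (?q j) = i"
      using preimage ..
    then show "i \<in> range (\<lambda>j :: 'd. coord (?q j))"
      by (rule range_eqI[OF sym])
  qed
  have "range (\<lambda>j. shift k v $ j) = ($) v ` range (\<lambda>j. coord (?q j))"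
    by (simp only: shift_def vec_lambda_beta image_image)
  then show ?thesis
    by (simp only: surj)
qed

lemma max_norm_shift: "max_norm (shift k v) = max_norm v"
  for v :: "complex ^ 'd::{finite,linorder}"
proof -
  have "range (\<lambda>j. cmod (u $ j)) = cmod ` range (($) u)" for u :: "complex ^ 'd::{finite,linorder}"
    by (simp add: image_image)
  then show ?thesis
    by (simp only: max_norm_def range_shift)
qed

section \<open>The discrete Fourier transform\<close>

text \<open>
  Entry \<open>(i, j)\<close> is the sum of the powers \<open>q\<^sup>0, \<dots>, q\<^sup>d\<^sup>-\<^sup>1\<close>, where \<open>q\<close> is the quotient of the \<open>d\<close>-th roots
  of unity belonging to \<open>i\<close> and \<open>j\<close>. Off the diagonal \<open>q \<noteq> 1\<close> and \<open>q\<^sup>d = 1\<close>, so the sum vanishes.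
\<close>

lemma DFT_gram:
  "conj_transpose DFT ** (DFT :: complex ^ 'd::{finite,linorder} ^ 'd::{finite,linorder}) = mat (of_nat CARD('d))"
proof -
  let ?n = "CARD('d)"
  let ?e = "\<lambda>m :: nat. exp (2 * of_real pi * \<i> * of_nat m / of_nat ?n)"
  have n: "1 \<le> ?n"
    by (simp add: Suc_le_eq)
  have entry: "cnj (DFT $ k $ i) * DFT $ k $ j = (?e (pos i - 1) / ?e (pos j - 1)) ^ (pos k - 1)"
    for i j k :: 'd
    by (simp add: DFT_def exp_cnj exp_of_nat_mult[symmetric] exp_diff[symmetric] exp_add[symmetric]
        ring_distribs diff_divide_distrib algebra_simps)
  have gram: "(\<Sum>k\<in>UNIV. cnj (DFT $ k $ i) * DFT $ k $ j) = (if i = j then of_nat ?n else 0)"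
    for i j :: 'd
  proof -
    let ?q = "?e (pos i - 1) / ?e (pos j - 1)"
    have "(\<Sum>k::'d\<in>UNIV. cnj (DFT $ k $ i) * DFT $ k $ j) = (\<Sum>m\<in>{1..?n}. ?q ^ (m - 1))"
      unfolding entry by (rule sum.reindex_bij_betw[OF bij_betw_pos])
    also have "\<dots> = (\<Sum>m<?n. ?q ^ m)"
      by (rule sum.reindex_bij_witness[of _ Suc "\<lambda>m. m - 1"]) auto
    also have "\<dots> = (if i = j then of_nat ?n else 0)"
    proof (cases "i = j")
      case False
      have p: "1 \<le> pos l" "pos l \<le> ?n" for l :: 'd
        using bij_betw_pos[where 'd='d] by (auto simp: bij_betw_def)
      have "pos i \<noteq> pos j"
        using False bij_betw_pos[where 'd='d] by (auto simp: bij_betw_def inj_def)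
      then have "(pos i - 1) mod ?n \<noteq> (pos j - 1) mod ?n"
        using p[of i] p[of j] by simp
      then have "?e (pos i - 1) \<noteq> ?e (pos j - 1)"
        by (subst complex_root_unity_eq[OF n]) (simp add: cong_def)
      then have "?q \<noteq> 1"
        by simp
      moreover have "?q ^ ?n = 1"
        unfolding power_divide using complex_root_unity[of ?n] by simp
      ultimately show ?thesis
        using False by (simp add: geometric_sum)
    qed simp
    finally show ?thesis .
  qed
  show ?thesis
    using gram by (simp add: vec_eq_iff matrix_matrix_mult_def conj_transpose_def mat_def)
qed

lemma conj_transpose_DFT_mult_vec:
  "conj_transpose DFT *v (DFT *v u) = real CARD('d) *\<^sub>R u"
  for u :: "complex ^ 'd::{finite,linorder}"
proof -
  have "mat (of_nat CARD('d)) *v u = real CARD('d) *\<^sub>R u"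
    by (simp add: mat_def vec_eq_iff matrix_vector_mult_def if_distrib if_distribR
        scaleR_conv_of_real[where 'a = complex] cong: if_cong)
  then show ?thesis
    by (simp only: matrix_vector_mul_assoc DFT_gram)
qed

lemma invertible_DFT: "invertible (DFT :: complex ^ 'd::{finite,linorder} ^ 'd::{finite,linorder})"
proof -
  have "inj ((*v) (DFT :: complex ^ 'd::{finite,linorder} ^ 'd::{finite,linorder}))"
    by (rule inj_on_inverseI[where g = "\<lambda>u. (1 / real CARD('d)) *\<^sub>R (conj_transpose DFT *v u)"])
      (simp add: conj_transpose_DFT_mult_vec)
  then show ?thesis
    by (simp add: invertible_left_inverse matrix_left_invertible_injective)
qed

lemma conj_transpose_DFT_eq_matrix_inv:
  "conj_transpose DFT *v u = real CARD('d) *\<^sub>R (matrix_inv DFT *v u)"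
  for u :: "complex ^ 'd::{finite,linorder}"
proof -
  have "DFT ** matrix_inv DFT = (mat 1 :: complex ^ 'd::{finite,linorder} ^ 'd::{finite,linorder})"
    using invertible_DFT someI_ex[of "\<lambda>B. DFT ** B = mat 1 \<and> B ** DFT = mat 1"]
    unfolding invertible_def matrix_inv_def by blast
  then have "DFT *v (matrix_inv DFT *v u) = u"
    by (simp add: matrix_vector_mul_assoc)
  then show ?thesis
    using conj_transpose_DFT_mult_vec[of "matrix_inv DFT *v u"] by simp
qed

lemma norm_DFT_mult_vec: "norm (DFT *v u) = sqrt (real CARD('d)) * norm u"
  for u :: "complex ^ 'd::{finite,linorder}"
proof -
  have "(norm (DFT *v u))\<^sup>2 = (conj_transpose DFT *v (DFT *v u)) \<bullet> u"
    by (simp only: conj_transpose_inner dot_square_norm)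
  also have "\<dots> = real CARD('d) * (norm u)\<^sup>2"
    by (simp add: conj_transpose_DFT_mult_vec dot_square_norm)
  finally show ?thesis
    by (metis abs_norm_cancel real_sqrt_abs real_sqrt_mult)
qed

section \<open>The spectral norm of the row blocks\<close>

lemma spectral_norm_DFT_mult:
  "spectral_norm (DFT ** B) = sqrt (real CARD('d)) * spectral_norm B"
  for B :: "complex ^ 'n ^ 'd::{finite,linorder}"
proof -
  have "spectral_norm (DFT ** B) = onorm (\<lambda>u. sqrt (real CARD('d)) *\<^sub>R (B *v u))"
    by (simp add: spectral_norm_def onorm_def matrix_vector_mul_assoc[symmetric] norm_DFT_mult_vec)
  also have "\<dots> = sqrt (real CARD('d)) * spectral_norm B"
    by (simp add: spectral_norm_def onorm_scaleR[OF matrix_vector_mul_bounded_linear])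
  finally show ?thesis .
qed

text \<open>The bound by the maximum norm is attained at the coordinate vector of an entry of largest modulus.\<close>

lemma spectral_norm_diag: "spectral_norm (diag v) = max_norm v"
proof (rule antisym)
  have entry: "cmod (v $ j) \<le> max_norm v" for j
    by (simp add: max_norm_def)
  then have "0 \<le> max_norm v"
    using norm_ge_zero order_trans by blast
  then have "norm (v * u) \<le> max_norm v * norm u" for u
    unfolding norm_vec_def
    by (subst L2_set_right_distrib)
      (auto intro!: L2_set_mono simp: norm_mult mult_right_mono entry)
  then show "spectral_norm (diag v) \<le> max_norm v"
    unfolding spectral_norm_def diag_mult_vec by (rule onorm_le)
  have "cmod (v $ j) \<le> spectral_norm (diag v)" for j
  proof -
    have "v * axis j 1 = axis j (v $ j)"
      by (simp add: vec_eq_iff axis_def)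
    moreover have "norm (axis j c) = cmod c" for c :: complex
      by (simp add: norm_vec_def L2_set_def axis_def if_distrib if_distribR cong: if_cong)
    ultimately show ?thesis
      using onorm[OF matrix_vector_mul_bounded_linear, of "diag v" "axis j 1"]
      by (simp add: spectral_norm_def diag_mult_vec)
  qed
  then show "max_norm v \<le> spectral_norm (diag v)"
    by (simp add: max_norm_def)
qed

lemma spectral_norm_ptycho_block:
  "(spectral_norm (block (ptycho_matrix w s) r))\<^sup>2 = real CARD('d) * (max_norm w)\<^sup>2"
  for w :: "complex ^ 'd::{finite,linorder}"
proof -
  have "spectral_norm (block (ptycho_matrix w s) r) = sqrt (real CARD('d)) * max_norm w"
    by (simp only: block_ptycho_matrix spectral_norm_DFT_mult spectral_norm_diag max_norm_shift)
  then show ?thesis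
    by (simp only: power_mult_distrib real_sqrt_pow2 of_nat_0_le_iff)
qed

section \<open>The update of the Ptychographic Iterative Engine as a gradient step\<close>

text \<open>
  The adjoint of \<open>F diag(v)\<close> undoes the Fourier transform up to the factor \<open>d\<close>; this brings the
  gradient into the form of the bracket in the Ptychographic Iterative Engine.
\<close>

lemma amp_grad_block_ptycho:
  "amp_grad_block (ptycho_matrix w s) y r z =
     real CARD('d) *\<^sub>R
       (diag (entrywise cnj (shift (s r) w)) *v
         (shift (s r) w * z
          - matrix_inv DFT *v
             (entrywise (\<lambda>b. of_real (sqrt b)) (block y r)
              * entrywise sgn (DFT *v (shift (s r) w * z)))))"
  for w :: "complex ^ 'd::{finite,linorder}"
proof -
  let ?v = "shift (s r) w"
  let ?c = "entrywise (\<lambda>b. of_real (sqrt b)) (block y r) * entrywise sgn (DFT *v (?v * z))"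
  have forward: "block (ptycho_matrix w s) r *v z = DFT *v (?v * z)"
    by (simp only: block_ptycho_matrix matrix_vector_mul_assoc[symmetric] diag_mult_vec)
  have "amp_grad_block (ptycho_matrix w s) y r z =
      entrywise cnj ?v * (conj_transpose DFT *v (DFT *v (?v * z) - ?c))"
    by (simp only: amp_grad_block_def forward block_ptycho_matrix conj_transpose_matrix_mult
        conj_transpose_diag matrix_vector_mul_assoc[symmetric] diag_mult_vec)
  also have "\<dots> = entrywise cnj ?v * (real CARD('d) *\<^sub>R (?v * z - matrix_inv DFT *v ?c))"
    by (simp only: matrix_vector_mult_diff_distrib conj_transpose_DFT_mult_vec
        conj_transpose_DFT_eq_matrix_inv[of ?c] scaleR_diff_right)
  finally show ?thesis
    by (simp only: diag_mult_vec mult_scaleR_right)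
qed

lemma pie_update_eq_gradient_step:
  "pie_update w s y a r z =
     z - (a / (real CARD('d) * (max_norm w)\<^sup>2)) *\<^sub>R amp_grad_block (ptycho_matrix w s) y r z"
  for w :: "complex ^ 'd::{finite,linorder}"
  by (simp add: pie_update_def amp_grad_block_ptycho matrix_vector_mult_diff_distrib
      scaleR_diff_right)

section \<open>Sampling one index per step\<close>

lemma stoch_grad_single: "stoch_grad p A y 1 rs z = (1 / p (rs 1)) *\<^sub>R amp_grad_block A y (rs 1) z"
  by (simp add: stoch_grad_def)

text \<open>
  Injectivity of \<open>f\<close> is essential: otherwise the same variable could occur twice, and it is in general
  not independent of itself. In the proof it allows events chosen for the indices in \<open>J\<close> to be
  transported to their images under \<open>f\<close>.
\<close>

lemma (in prob_space) indep_vars_reindex: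
  assumes inj: "inj_on f I" and indep: "indep_vars N X (f ` I)"
  shows "indep_vars (\<lambda>i. N (f i)) (\<lambda>i. X (f i)) I"
proof -
  let ?F = "\<lambda>i. {X i -` B \<inter> space M |B. B \<in> sets (N i)}"
  have F: "indep_sets ?F (f ` I)" and rv: "\<And>i. i \<in> I \<Longrightarrow> random_variable (N (f i)) (X (f i))"
    using indep by (auto simp: indep_vars_def2)
  have "indep_sets (\<lambda>i. ?F (f i)) I"
  proof (rule indep_setsI)
    show "?F (f i) \<subseteq> events" if "i \<in> I" for i
      using F that unfolding indep_sets_def by blast
    fix A J
    assume J: "J \<noteq> {}" "J \<subseteq> I" "finite J" and A: "\<forall>j\<in>J. A j \<in> ?F (f j)"
    have injJ: "inj_on f J"
      using inj J(2) by (rule inj_on_subset)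
    define A' where "A' = (\<lambda>i. A (the_inv_into J f i))"
    have A': "A' (f j) = A j" if "j \<in> J" for j
      unfolding A'_def by (simp add: the_inv_into_f_f[OF injJ that])
    have "prob (\<Inter>j\<in>J. A j) = prob (\<Inter>i\<in>f ` J. A' i)"
      by (simp add: A' cong: INF_cong_simp)
    also have "\<dots> = (\<Prod>i\<in>f ` J. prob (A' i))"
    proof (rule indep_setsD[OF F])
      show "\<forall>i\<in>f ` J. A' i \<in> ?F i"
      proof
        fix i
        assume "i \<in> f ` J"
        then obtain j where "i = f j" "j \<in> J" ..
        then show "A' i \<in> ?F i"
          using bspec[OF A \<open>j \<in> J\<close>] by (simp only: A')
      qed
    qed (use J in \<open>simp_all add: image_mono\<close>)
    also have "\<dots> = (\<Prod>j\<in>J. prob (A j))"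
      by (simp add: prod.reindex[OF injJ] A')
    finally show "prob (\<Inter>j\<in>J. A j) = (\<Prod>j\<in>J. prob (A j))" .
  qed
  then show ?thesis
    using rv by (simp add: indep_vars_def2)
qed

text \<open>
  The bijection between \<open>t\<close> and \<open>(t, 1)\<close> transports independence in both directions, along
  \<open>t \<mapsto> (t, 1)\<close> and along \<open>fst\<close>.
\<close>

lemma iid_samples_single:
  fixes \<rho> :: "'i \<Rightarrow> 'w \<Rightarrow> 'r"
  assumes "prob_space M"
  shows "iid_samples M p (UNIV \<times> {1..1::nat}) (\<lambda>(t, k). \<rho> t) \<longleftrightarrow> iid_samples M p UNIV \<rho>"
proof -
  interpret prob_space M by fact
  let ?N = "\<lambda>_. count_space UNIV"
  have "indep_vars ?N (\<lambda>(t, k). \<rho> t) (UNIV \<times> {1..1::nat}) \<longleftrightarrow> indep_vars ?N \<rho> UNIV"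
  proof
    have "(UNIV :: 'i set) \<times> {1..1::nat} = (\<lambda>t. (t, 1)) ` UNIV"
      by auto
    moreover assume "indep_vars ?N (\<lambda>(t, k). \<rho> t) (UNIV \<times> {1..1::nat})"
    ultimately have "indep_vars ?N (\<lambda>(t, k). \<rho> t) ((\<lambda>t. (t, 1::nat)) ` UNIV)"
      by (simp only:)
    from indep_vars_reindex[OF _ this] show "indep_vars ?N \<rho> UNIV"
      by (simp add: inj_def)
  next
    have "fst ` ((UNIV :: 'i set) \<times> {1..1::nat}) = UNIV"
      by auto
    moreover assume "indep_vars ?N \<rho> UNIV"
    ultimately have "indep_vars ?N \<rho> (fst ` (UNIV \<times> {1..1::nat}))"
      by (simp only:)
    from indep_vars_reindex[OF _ this]
    show "indep_vars ?N (\<lambda>(t, k). \<rho> t) (UNIV \<times> {1..1::nat})"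
      by (simp add: inj_on_def case_prod_unfold)
  qed
  then show ?thesis
    by (auto simp: iid_samples_def)
qed

theorem theorem3p12:
  fixes w x :: "complex ^ 'd::{finite,linorder}"
    and s :: "'r::finite \<Rightarrow> nat"
    and y :: "real ^ ('r \<times> 'd)"
    and n :: "'r \<Rightarrow> real ^ 'd::{finite,linorder}"
    and A :: "complex ^ 'd::{finite,linorder} ^ ('r \<times> 'd)"
    and p :: "'r \<Rightarrow> real"
    and \<alpha> :: "nat \<Rightarrow> real"
    and M :: "'w measure"
  assumes "w \<noteq> 0"
    and "inj s" and "range s \<subseteq> {1..CARD('d)}"
    and "\<And>r. block y r = ptycho_measurement w (s r) x (n r)"
    and "\<And>i. 0 \<le> y $ i"
    and "A = ptycho_matrix w s"
    and "\<And>r. 0 < p r" and "\<And>r. p r < 1" and "(\<Sum>r\<in>UNIV. p r) = 1"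
    and "\<And>t. 0 < \<alpha> t"
    and "prob_space M"
  shows "(\<forall>t r. \<alpha> t * p r / (real CARD('d) * (max_norm w)\<^sup>2)
            = \<alpha> t * p r / (spectral_norm (block A r))\<^sup>2) \<and>
    (\<forall>r z. stoch_grad p A y 1 (\<lambda>_. r) z = (1 / p r) *\<^sub>R amp_grad_block A y r z) \<and>
    (\<forall>t r z. pie_update w s y (\<alpha> t) r z
            = z - (\<alpha> t * p r / (real CARD('d) * (max_norm w)\<^sup>2)) *\<^sub>R stoch_grad p A y 1 (\<lambda>_. r) z) \<and>
    (\<forall>\<rho> Z. pie_iteration M p w s y \<alpha> \<rho> Z \<longleftrightarrow>
            saf_iteration M p A y 1
              (\<lambda>t \<omega>. \<alpha> t * p (\<rho> t \<omega>) / (real CARD('d) * (max_norm w)\<^sup>2)) (\<lambda>t _. \<rho> t) Z)"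
proof (intro conjI allI)
  show "\<alpha> t * p r / (real CARD('d) * (max_norm w)\<^sup>2)
      = \<alpha> t * p r / (spectral_norm (block A r))\<^sup>2" for t r
    unfolding \<open>A = ptycho_matrix w s\<close> spectral_norm_ptycho_block ..
  show "stoch_grad p A y 1 (\<lambda>_. r) z = (1 / p r) *\<^sub>R amp_grad_block A y r z" for r z
    by (rule stoch_grad_single)
  have step: "pie_update w s y (\<alpha> t) r z
      = z - (\<alpha> t * p r / (real CARD('d) * (max_norm w)\<^sup>2)) *\<^sub>R stoch_grad p A y 1 (\<lambda>_. r) z" for t r z
  proof -
    have "p r \<noteq> 0"
      using \<open>\<And>r. 0 < p r\<close>[of r] by simp
    then show ?thesis
      by (simp add: pie_update_eq_gradient_step stoch_grad_single[simplified] \<open>A = ptycho_matrix w s\<close>)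
  qed
  then show "pie_update w s y (\<alpha> t) r z
      = z - (\<alpha> t * p r / (real CARD('d) * (max_norm w)\<^sup>2)) *\<^sub>R stoch_grad p A y 1 (\<lambda>_. r) z" for t r z .
  show "pie_iteration M p w s y \<alpha> \<rho> Z \<longleftrightarrow>
      saf_iteration M p A y 1
        (\<lambda>t \<omega>. \<alpha> t * p (\<rho> t \<omega>) / (real CARD('d) * (max_norm w)\<^sup>2)) (\<lambda>t _. \<rho> t) Z" for \<rho> Z
    unfolding pie_iteration_def saf_iteration_def step iid_samples_single[OF \<open>prob_space M\<close>] ..
qed

end
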